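(* Let $X$ be a homogeneous domain in $\mathbb{C}^n$ and let $L$ and $M$ be non-degenerate sesqui-holomorphic projectively invariant functions on $X$, with multipliers $\omega^L$ and $\omega^M$. If $\omega^L\approx\omega^M$, then there is $c>0$ such that $M=cL$.
   Context: A domain is an open connected set; $Aut(X)$ is the group of biholomorphisms of $X$ onto itself; $X$ is homogeneous if $Aut(X)$ acts transitively on $X$. A function $L:X\times X\to\mathbb{C}$ is sesqui-holomorphic if it is holomorphic in the first and antiholomorphic in the second variable; it is non-degenerate if $L(x,x)>0$ for all $x\in X$. For non-degenerate $L,M$, a function $\omega:X\to\mathbb{C}$ rescales $L$ to $M$ if $M(x,y)=\omega(x)\overline{\omega(y)}L(x,y)$ for all $x,y\in X$; then $L$ and $M$ are called rescallings of each other. For $\Phi:X\to X$, $[L\circ\Phi](x,y)=L(\Phi(x),\Phi(y))$. A sesqui-holomorphic non-degenerate $L$ is projectively invariant if $L\circ\Phi$ is a rescalling of $L$ for every $\Phi\in Aut(X)$. A multiplier of such $L$ is a function $\omega^L:Aut(X)\times X\to\mathbb{C}\setminus\{0\}$ such that $\omega^L_\Phi=\omega^L(\Phi,\cdot)$ rescales $L\circ\Phi$ to $L$ for every $\Phi\in Aut(X)$; it is determined by $L$ up to multiplication by a function from $Aut(X)$ to the unit circle $\mathbb{T}$. The notation $\omega^L\approx\omega^M$ means that there is a function $\tau:Aut(X)\to\mathbb{T}$ with $\omega^L_\Phi=\tau(\Phi)\,\omega^M_\Phi$ on $X$ for every $\Phi\in Aut(X)$. *)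

theory Defs
  imports "HOL-Analysis.Analysis"
begin

(* Holomorphy in several variables: Frechet differentiable with a complex-linear derivative
   ("has_derivative" itself only asks for real-linearity). *)
definition holo_fun_on :: "(complex^'n \<Rightarrow> complex) \<Rightarrow> (complex^'n) set \<Rightarrow> bool" where
  "holo_fun_on f X \<longleftrightarrow>
     (\<forall>x\<in>X. \<exists>f'. (f has_derivative f') (at x) \<and> (\<forall>a v. f' (a *s v) = a * f' v))"

definition antiholo_fun_on :: "(complex^'n \<Rightarrow> complex) \<Rightarrow> (complex^'n) set \<Rightarrow> bool" where
  "antiholo_fun_on f X \<longleftrightarrow> holo_fun_on (\<lambda>x. cnj (f x)) X"

definition holo_map_on :: "(complex^'n \<Rightarrow> complex^'m) \<Rightarrow> (complex^'n) set \<Rightarrow> bool" where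
  "holo_map_on f X \<longleftrightarrow> (\<forall>i. holo_fun_on (\<lambda>x. f x $ i) X)"

definition complex_domain :: "(complex^'n) set \<Rightarrow> bool" where
  "complex_domain X \<longleftrightarrow> open X \<and> connected X"

(* Self-maps of X are total functions on the ambient space. Requiring "extensional X" makes
   each biholomorphism of X be represented by exactly one such function, so that functions
   defined on Aut X cannot depend on irrelevant values outside X. *)
definition Aut :: "(complex^'n) set \<Rightarrow> (complex^'n \<Rightarrow> complex^'n) set" where
  "Aut X = {\<Phi> \<in> extensional X.
     bij_betw \<Phi> X X \<and> holo_map_on \<Phi> X \<and> holo_map_on (inv_into X \<Phi>) X}"

definition homogeneous_set :: "(complex^'n) set \<Rightarrow> bool" where
  "homogeneous_set X \<longleftrightarrow> (\<forall>x\<in>X. \<forall>y\<in>X. \<exists>\<Phi>\<in>Aut X. \<Phi> x = y)"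

(* Functions on X \<times> X are curried; their values outside X are irrelevant throughout. *)
type_synonym 'n kern = "complex^'n \<Rightarrow> complex^'n \<Rightarrow> complex"

definition sesqui_holomorphic :: "(complex^'n) set \<Rightarrow> 'n::finite kern \<Rightarrow> bool" where
  "sesqui_holomorphic X L \<longleftrightarrow>
     (\<forall>y\<in>X. holo_fun_on (\<lambda>x. L x y) X) \<and> (\<forall>x\<in>X. antiholo_fun_on (\<lambda>y. L x y) X)"

definition nondegenerate :: "(complex^'n) set \<Rightarrow> 'n::finite kern \<Rightarrow> bool" where
  "nondegenerate X L \<longleftrightarrow> (\<forall>x\<in>X. L x x \<in> \<real> \<and> Re (L x x) > 0)"

definition rescales ::
  "(complex^'n) set \<Rightarrow> (complex^'n \<Rightarrow> complex) \<Rightarrow> 'n::finite kern \<Rightarrow> 'n kern \<Rightarrow> bool" where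
  "rescales X \<omega> L M \<longleftrightarrow> (\<forall>x\<in>X. \<forall>y\<in>X. M x y = \<omega> x * cnj (\<omega> y) * L x y)"

definition pull :: "'n::finite kern \<Rightarrow> (complex^'n \<Rightarrow> complex^'n) \<Rightarrow> 'n kern" where
  "pull L \<Phi> = (\<lambda>x y. L (\<Phi> x) (\<Phi> y))"

definition projectively_invariant :: "(complex^'n) set \<Rightarrow> 'n::finite kern \<Rightarrow> bool" where
  "projectively_invariant X L \<longleftrightarrow> (\<forall>\<Phi>\<in>Aut X. \<exists>\<omega>. rescales X \<omega> L (pull L \<Phi>))"

definition is_multiplier ::
  "(complex^'n) set \<Rightarrow> 'n::finite kern \<Rightarrow>
   ((complex^'n \<Rightarrow> complex^'n) \<Rightarrow> complex^'n \<Rightarrow> complex) \<Rightarrow> bool" where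
  "is_multiplier X L \<omega> \<longleftrightarrow>
     (\<forall>\<Phi>\<in>Aut X. (\<forall>x\<in>X. \<omega> \<Phi> x \<noteq> 0) \<and> rescales X (\<omega> \<Phi>) (pull L \<Phi>) L)"

definition multiplier_equiv ::
  "(complex^'n) set \<Rightarrow> ((complex^'n \<Rightarrow> complex^'n) \<Rightarrow> complex^'n \<Rightarrow> complex) \<Rightarrow>
   ((complex^'n \<Rightarrow> complex^'n) \<Rightarrow> complex^'n \<Rightarrow> complex) \<Rightarrow> bool" where
  "multiplier_equiv X \<omega> \<omega>' \<longleftrightarrow>
     (\<exists>\<tau>. (\<forall>\<Phi>\<in>Aut X. \<tau> \<Phi> \<in> sphere (0::complex) 1) \<and>
          (\<forall>\<Phi>\<in>Aut X. \<forall>x\<in>X. \<omega> \<Phi> x = \<tau> \<Phi> * \<omega>' \<Phi> x))"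

end

theory Submission
  imports Defs "HOL-Complex_Analysis.Complex_Analysis"
begin

text \<open>Both \<open>L x x\<close> and \<open>M x x\<close> are multiplied by the same positive factor under an automorphism,
  because equivalent multipliers have equal modulus. Hence \<open>M x x / L x x\<close> is invariant, and by
  homogeneity it is a constant \<open>c\<close>. The sesqui-holomorphic function \<open>M - c L\<close> vanishes on the
  diagonal, hence everywhere. Only separate holomorphy is available for this last step; in place
  of Hartogs' theorem, Baire's theorem gives boundedness on some small square \<open>V \<times> V\<close>, and
  bounded separately holomorphic functions of two complex variables are holomorphic on the
  diagonal.\<close>

section \<open>One complex variable: Lipschitz estimates and holomorphy along the diagonal\<close>

text \<open>Closed discs of radius \<open>r/2\<close> about points of the half-size disc stay inside
  \<open>ball z r\<close>, so Cauchy's inequality bounds the derivative there by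
  \<open>2 * B / r\<close>; the half-size disc is convex, so the mean value inequality
  applies.\<close>

lemma holomorphic_lipschitz:
  assumes hol: "f holomorphic_on ball z r" and bd: "\<And>v. v \<in> ball z r \<Longrightarrow> cmod (f v) \<le> B"
    and w: "w \<in> ball z (r/2)"
  shows "cmod (f w - f z) \<le> 2 * B / r * cmod (w - z)"
proof (rule field_differentiable_bound[of "ball z (r/2)" f "deriv f"])
  have r: "r > 0"
    using w by (metis ball_empty empty_iff half_gt_zero_iff not_less)
  show "w \<in> ball z (r/2)" "z \<in> ball z (r/2)" using w r by auto
  fix v assume v: "v \<in> ball z (r/2)"
  have sub: "cball v (r/2) \<subseteq> ball z r"
  proof
    fix u assume "u \<in> cball v (r/2)"
    then show "u \<in> ball z r"
      using v dist_triangle[of z u v] by auto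
  qed
  have vr: "v \<in> ball z r" using v r by auto
  then show "(f has_field_derivative deriv f v) (at v within ball z (r/2))"
    using holomorphic_derivI[OF hol open_ball] has_field_derivative_at_within by blast
  have "cmod ((deriv ^^ 1) f v) \<le> fact 1 * B / (r/2) ^ 1"
  proof (rule Cauchy_inequality)
    show "f holomorphic_on ball v (r/2)"
      using hol sub ball_subset_cball by (meson holomorphic_on_subset subset_trans)
    show "continuous_on (cball v (r/2)) f"
      using hol sub by (meson holomorphic_on_imp_continuous_on holomorphic_on_subset)
    show "cmod (f x) \<le> B" if "cmod (v - x) = r/2" for x
      using that sub by (intro bd) (auto simp: dist_norm subset_iff)
  qed (use r in auto)
  then show "cmod (deriv f v) \<le> 2 * B / r" by (simp add: mult.commute)
qed auto

text \<open>The mixed second difference of \<open>F\<close> is of second order, so the diagonal inherits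
  differentiability from the two partial functions.\<close>
lemma separately_holomorphic_diagonal:
  fixes F :: "complex \<Rightarrow> complex \<Rightarrow> complex"
  assumes h1: "\<And>t. t \<in> ball 0 R \<Longrightarrow> (\<lambda>s. F s t) holomorphic_on ball 0 R"
    and h2: "\<And>s. s \<in> ball 0 R \<Longrightarrow> F s holomorphic_on ball 0 R"
    and bd: "\<And>s t. s \<in> ball 0 R \<Longrightarrow> t \<in> ball 0 R \<Longrightarrow> cmod (F s t) \<le> B"
  shows "(\<lambda>s. F s s) holomorphic_on ball 0 R"
proof -
  have "(\<lambda>s. F s s) field_differentiable (at s)" if s: "s \<in> ball 0 R" for s
  proof -
    define d where "d = R - cmod s"
    have d: "d > 0" using s by (simp add: d_def)
    have sub: "ball s d \<subseteq> ball 0 R"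
      unfolding d_def
    proof
      fix v assume "v \<in> ball s (R - cmod s)"
      then show "v \<in> ball 0 R"
        using norm_triangle_sub[of v s] by (simp add: dist_norm norm_minus_commute)
    qed
    \<comment> \<open>Adding the two partial functions through \<open>s\<close> to
      \<open>\<rho>\<close> recovers the diagonal up to the constant \<open>F s s\<close>. The form
      of \<open>C\<close> reflects two uses of the Lipschitz estimate on
      \<open>ball s d\<close>.\<close>
    define \<rho> where "\<rho> = (\<lambda>w. F w w - F w s - F s w + F s s)"
    define C where "C = 2 * (2 * B / d) / d"
    have \<rho>: "cmod (\<rho> w) \<le> C * cmod (w - s) ^ 2" if w: "w \<in> ball s (d/2)" for w
    proof -
      have wR: "w \<in> ball 0 R" using w subset_ball[of "d/2" d s] sub d by (auto simp del: mem_ball)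
      have 1: "cmod (F z w - F z s) \<le> 2 * B / d * cmod (w - s)" if z: "z \<in> ball s d" for z
      proof (rule holomorphic_lipschitz[OF _ _ w])
        have zR: "z \<in> ball 0 R" using z sub by blast
        then show "F z holomorphic_on ball s d"
          using h2 sub holomorphic_on_subset by blast
        show "cmod (F z v) \<le> B" if "v \<in> ball s d" for v
          using that zR sub by (intro bd) auto
      qed
      \<comment> \<open>The increment in the second variable, already of order
        \<open>cmod (w - s)\<close>, now serves as the bounded function in the first variable; this
        yields the second factor \<open>cmod (w - s)\<close>.\<close>
      have "(\<lambda>z. F z w - F z s) holomorphic_on ball s d"
        using h1[OF wR] h1[OF s] sub by (intro holomorphic_intros) (auto intro: holomorphic_on_subset)
      from holomorphic_lipschitz[OF this 1 w]
      show ?thesis by (simp add: \<rho>_def C_def power2_eq_square algebra_simps)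
    qed
    have "(\<rho> has_field_derivative 0) (at s)"
    proof -
      have "((\<lambda>w. C * cmod (w - s)) \<longlongrightarrow> C * cmod (s - s)) (at s)"
        by (intro tendsto_intros)
      then have lim: "((\<lambda>w. C * cmod (w - s)) \<longlongrightarrow> 0) (at s)" by simp
      have ev: "\<forall>\<^sub>F w in at s. w \<in> ball s (d/2) - {s}"
        using d by (intro eventually_at_in_open) auto
      have "((\<lambda>w. (\<rho> w - \<rho> s) / (w - s)) \<longlongrightarrow> 0) (at s)"
        using _ lim
      proof (rule Lim_null_comparison)
        show "\<forall>\<^sub>F w in at s. cmod ((\<rho> w - \<rho> s) / (w - s)) \<le> C * cmod (w - s)"
          using ev
        proof eventually_elim
          case (elim w)
          have "\<rho> s = 0" by (simp add: \<rho>_def)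
          with elim \<rho>[of w] show ?case
            by (simp add: norm_divide divide_simps power2_eq_square mult.assoc)
        qed
      qed
      then show ?thesis by (simp add: has_field_derivative_iff)
    qed
    then have "\<rho> field_differentiable (at s)"
      using field_differentiable_def by blast
    moreover have "(\<lambda>w. F w s) field_differentiable (at s)" "F s field_differentiable (at s)"
      using h1[OF s] h2[OF s] s by (auto intro: holomorphic_on_imp_differentiable_at)
    ultimately have "(\<lambda>w. \<rho> w + F w s + F s w - F s s) field_differentiable (at s)"
      by (intro field_differentiable_add field_differentiable_diff field_differentiable_const)
    then show ?thesis by (simp add: \<rho>_def)
  qed
  then show ?thesis
    by (auto simp: holomorphic_on_def intro: field_differentiable_at_within)
qed

section \<open>Restriction to complex lines\<close>

lemma norm_vector_smult: "norm (a *s (v::complex^'n)) = cmod a * norm v"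
  by (simp add: norm_vec_def L2_set_def vector_scalar_mult_def norm_mult power_mult_distrib
      sum_distrib_left[symmetric] real_sqrt_mult)

lemma has_derivative_complex_line:
  "((\<lambda>s. q + s *s (u::complex^'n)) has_derivative (\<lambda>s. s *s u)) (at s)"
proof -
  have "bounded_linear (\<lambda>s. s *s u)"
    by (rule bounded_linear_intro[of _ "norm u"])
      (auto simp: norm_vector_smult vec_eq_iff algebra_simps)
  then show ?thesis
    by (auto intro!: derivative_eq_intros bounded_linear_imp_has_derivative)
qed

lemma open_complex_line_vimage:
  assumes "open S"
  shows "open {s. q + s *s (u::complex^'n) \<in> S}"
proof -
  have "continuous_on UNIV (\<lambda>s. q + s *s u)"
    using has_derivative_complex_line by (metis continuous_at_imp_continuous_on has_derivative_continuous)
  then show ?thesis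
    using open_vimage[OF assms] by (simp add: vimage_def)
qed

text \<open>By the chain rule the derivative is \<open>t\<close> mapped to
  \<open>f' (t *s u)\<close>, and complex linearity turns this into multiplication by
  \<open>f' u\<close>. This opens the way to one-variable theorems.\<close>

lemma holo_fun_on_complex_line:
  assumes "holo_fun_on f X" and "\<And>s. s \<in> S \<Longrightarrow> q + s *s u \<in> X"
  shows "(\<lambda>s. f (q + s *s u)) holomorphic_on S"
proof -
  have "(\<lambda>s. f (q + s *s u)) field_differentiable (at s)" if s: "s \<in> S" for s
  proof -
    obtain f' where f': "(f has_derivative f') (at (q + s *s u))" "\<forall>a v. f' (a *s v) = a * f' v"
      using bspec[OF assms(1)[unfolded holo_fun_on_def] assms(2)[OF s]] by blast
    have "((\<lambda>s. f (q + s *s u)) has_derivative (\<lambda>t. f' (t *s u))) (at s)"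
      by (rule has_derivative_compose[OF has_derivative_complex_line f'(1)])
    moreover have "(\<lambda>t. f' (t *s u)) = (*) (f' u)"
      using f'(2) by (simp add: fun_eq_iff mult.commute)
    ultimately have "((\<lambda>s. f (q + s *s u)) has_derivative (*) (f' u)) (at s)" by simp
    then show ?thesis
      by (auto simp: field_differentiable_def has_field_derivative_def)
  qed
  then show ?thesis
    by (auto simp: holomorphic_on_def intro: field_differentiable_at_within)
qed

lemma holo_fun_on_continuous: "holo_fun_on f X \<Longrightarrow> continuous_on X f"
  unfolding holo_fun_on_def
  by (blast intro: continuous_at_imp_continuous_on has_derivative_continuous)

lemma holo_fun_on_diff_cmult:
  assumes "holo_fun_on f X" "holo_fun_on g X"
  shows "holo_fun_on (\<lambda>x. f x - c * g x) X"
  unfolding holo_fun_on_def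
proof
  fix x assume "x \<in> X"
  then obtain f' g' where
    "(f has_derivative f') (at x)" "\<forall>a v. f' (a *s v) = a * f' v"
    "(g has_derivative g') (at x)" "\<forall>a v. g' (a *s v) = a * g' v"
    using assms unfolding holo_fun_on_def by blast
  then show "\<exists>h'. ((\<lambda>x. f x - c * g x) has_derivative h') (at x) \<and>
      (\<forall>a v. h' (a *s v) = a * h' v)"
    by (intro exI[of _ "\<lambda>v. f' v - c * g' v"])
      (auto intro!: derivative_eq_intros simp: algebra_simps)
qed

section \<open>Identity theorem in several variables\<close>

text \<open>The complex line through \<open>a\<close> and \<open>w\<close>, with parameters 0 and 1,
  meets the ball in a convex open set of parameters, where the one-variable identity theorem
  applies.\<close>

lemma holo_fun_on_eq_0_ball:
  assumes f: "holo_fun_on f (ball z r)" and V: "open V" "a \<in> V" "V \<subseteq> ball z r"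
    and f0: "\<And>x. x \<in> V \<Longrightarrow> f x = 0" and w: "w \<in> ball z r"
  shows "f w = 0"
proof -
  define S where "S = {s. a + s *s (w - a) \<in> ball z r}"
  define T where "T = {s. a + s *s (w - a) \<in> V}"
  have "convex S"
  proof (rule convexI)
    fix s t :: complex and \<mu> \<nu> :: real
    assume st: "s \<in> S" "t \<in> S" and \<mu>: "0 \<le> \<mu>" "0 \<le> \<nu>" "\<mu> + \<nu> = 1"
    have "a + (\<mu> *\<^sub>R s + \<nu> *\<^sub>R t) *s (w - a) =
      \<mu> *\<^sub>R (a + s *s (w - a)) + \<nu> *\<^sub>R (a + t *s (w - a))"
    proof -
      have b: "complex_of_real \<mu> * b + complex_of_real \<nu> * b = b" for b
        using \<mu>(3) by (metis distrib_right mult_1 of_real_1 of_real_add)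
      show ?thesis
        by (simp add: vec_eq_iff scaleR_conv_of_real[where 'a=complex] algebra_simps) (metis b)
    qed
    then show "\<mu> *\<^sub>R s + \<nu> *\<^sub>R t \<in> S"
      using convexD[OF convex_ball[of z r], of "a + s *s (w - a)" "a + t *s (w - a)" \<mu> \<nu>] st \<mu>
      by (simp add: S_def del: mem_ball)
  qed
  then have "connected S" by (rule convex_connected)
  have "open S" "open T"
    unfolding S_def T_def using V(1) by (intro open_complex_line_vimage; simp)+
  have "(\<lambda>s. f (a + s *s (w - a))) holomorphic_on S"
    using f by (rule holo_fun_on_complex_line) (simp add: S_def)
  moreover have mem: "0 \<in> T" "T \<subseteq> S" "1 \<in> S"
    using V w by (auto simp: S_def T_def)
  ultimately have "f (a + 1 *s (w - a)) = 0"
  proof (intro analytic_continuation_open[OF \<open>open T\<close> \<open>open S\<close> _ \<open>connected S\<close> mem(2),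
        of "\<lambda>s. f (a + s *s (w - a))" "\<lambda>_. 0" 1])
    show "f (a + s *s (w - a)) = 0" if "s \<in> T" for s
      using that by (intro f0) (simp add: T_def)
  qed auto
  then show ?thesis by simp
qed

text \<open>The interior of the zero set is open, relatively closed by the case of a ball, and
  nonempty; connectedness makes it all of \<open>X\<close>.\<close>

lemma holo_fun_on_identity:
  assumes f: "holo_fun_on f X" and X: "open X" "connected X"
    and V: "open V" "V \<noteq> {}" "V \<subseteq> X" and f0: "\<And>x. x \<in> V \<Longrightarrow> f x = 0" and w: "w \<in> X"
  shows "f w = 0"
proof -
  define Z where "Z = interior {x \<in> X. f x = 0}"
  have ZX: "Z \<subseteq> X" unfolding Z_def using interior_subset by fastforce
  have fZ: "f x = 0" if "x \<in> Z" for x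
    using that interior_subset unfolding Z_def by fastforce
  \<comment> \<open>A ball in \<open>X\<close> about a limit point of \<open>Z\<close> meets
    \<open>Z\<close> in a nonempty open set, so \<open>f\<close> vanishes on the whole ball.\<close>
  have "closure Z \<inter> X \<subseteq> Z"
  proof
    fix z assume z: "z \<in> closure Z \<inter> X"
    then obtain r where r: "r > 0" "ball z r \<subseteq> X"
      using X(1) open_contains_ball by blast
    have "ball z r \<inter> Z \<noteq> {}"
      using z r by (metis IntD1 centre_in_ball disjoint_iff open_Int_closure_eq_empty open_ball)
    then obtain a where a: "a \<in> ball z r \<inter> Z" by blast
    have "f w = 0" if "w \<in> ball z r" for w
    proof (rule holo_fun_on_eq_0_ball[of f z r "ball z r \<inter> Z" a])
      show "holo_fun_on f (ball z r)"
        using f r(2) unfolding holo_fun_on_def by blast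
    qed (use a that fZ in \<open>auto simp: Z_def\<close>)
    then have "ball z r \<subseteq> Z"
      unfolding Z_def using r(2) by (intro interior_maximal) auto
    then show "z \<in> Z" using r(1) by auto
  qed
  then have "Z = X \<inter> closure Z" using ZX closure_subset by blast
  then have "closedin (top_of_set X) Z"
    by (metis closedin_closed_Int closed_closure)
  moreover have "openin (top_of_set X) Z"
    by (rule open_subset[OF ZX]) (simp add: Z_def)
  ultimately have "Z = {} \<or> Z = X"
    using connected_clopen[THEN iffD1, OF X(2)] by metis
  moreover have "V \<subseteq> Z"
    unfolding Z_def using V f0 by (intro interior_maximal) auto
  ultimately show ?thesis using V(2) fZ w by auto
qed

section \<open>Sesqui-holomorphic functions vanishing on the diagonal\<close>

lemma sesqui_holomorphic_diff_cmult:
  assumes "sesqui_holomorphic X M" "sesqui_holomorphic X L"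
  shows "sesqui_holomorphic X (\<lambda>x y. M x y - complex_of_real c * L x y)"
  unfolding sesqui_holomorphic_def antiholo_fun_on_def complex_cnj_diff complex_cnj_mult
    complex_cnj_complex_of_real
  using assms unfolding sesqui_holomorphic_def antiholo_fun_on_def
  by (intro conjI ballI holo_fun_on_diff_cmult; blast)

text \<open>Joint boundedness near the diagonal is not part of separate holomorphy; it comes from
  Baire's theorem, applied to the second variable only.\<close>
lemma sesqui_holomorphic_locally_bounded:
  fixes N :: "'n::finite kern"
  assumes N: "sesqui_holomorphic X N" and X: "cball p r \<subseteq> X" and r: "r > 0"
  shows "\<exists>q \<delta> B. \<delta> > 0 \<and> ball q \<delta> \<subseteq> cball p r \<and>
    (\<forall>x\<in>cball p r. \<forall>y\<in>ball q \<delta>. cmod (N x y) \<le> B)"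
proof -
  let ?K = "cball p r"
  \<comment> \<open>Continuity in \<open>y\<close> makes each \<open>E k\<close> closed; continuity
    in \<open>x\<close> on the compact ball makes these sets cover \<open>?K\<close>.\<close>
  define E where "E = (\<lambda>k::nat. {y \<in> ?K. \<forall>x\<in>?K. cmod (N x y) \<le> real k})"
  have cy: "continuous_on ?K (\<lambda>y. N x y)" if "x \<in> ?K" for x
  proof -
    have "continuous_on ?K (\<lambda>y. cnj (N x y))"
      using N X that holo_fun_on_continuous continuous_on_subset
      unfolding sesqui_holomorphic_def antiholo_fun_on_def by blast
    from continuous_on_cnj[OF this] show ?thesis by simp
  qed
  have cl: "closed (E k)" for k
  proof -
    have "closed {y \<in> ?K. cmod (N x y) \<le> real k}" if "x \<in> ?K" for x
      using continuous_closed_preimage[OF cy[OF that], of "cball 0 (real k)"]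
      by (simp add: vimage_def Int_def)
    \<comment> \<open>Here \<open>r > 0\<close> matters: over an empty \<open>?K\<close> the
      intersection would be the whole space.\<close>
    moreover have "E k = (\<Inter>x\<in>?K. {y \<in> ?K. cmod (N x y) \<le> real k})"
      using r centre_in_cball[of p r] by (fastforce simp: E_def simp del: mem_cball centre_in_cball)
    ultimately show ?thesis by auto
  qed
  have cover: "\<exists>k. y \<in> E k" if y: "y \<in> ?K" for y
  proof -
    have "continuous_on ?K (\<lambda>x. N x y)"
      using N X y holo_fun_on_continuous continuous_on_subset
      unfolding sesqui_holomorphic_def by blast
    then have "bounded ((\<lambda>x. N x y) ` ?K)"
      by (intro compact_imp_bounded compact_continuous_image) auto
    then obtain b where b: "\<And>x. x \<in> ?K \<Longrightarrow> cmod (N x y) \<le> b"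
      unfolding bounded_iff by blast
    obtain k where "b \<le> real k" using real_arch_simple by blast
    then have "y \<in> E k" unfolding E_def using b y order_trans by blast
    then show ?thesis ..
  qed
  have "\<exists>k. interior (E k) \<noteq> {}"
  proof (rule ccontr)
    assume "\<not> ?thesis"
    then have empty: "interior (E k) = {}" for k by blast
    \<comment> \<open>If every \<open>E k\<close> had empty interior, the complements would be
      relatively open and dense, yet their intersection is empty.\<close>
    have "?K \<subseteq> closure (\<Inter>(range (\<lambda>k. ?K - E k)))"
    proof (rule Baire)
      fix T assume "T \<in> range (\<lambda>k. ?K - E k)"
      then obtain k where T: "T = ?K - E k" by blast
      have "openin (top_of_set ?K) T"
        unfolding T by (simp add: Diff_eq cl openin_open_Int open_Compl)
      \<comment> \<open>Density is checked on the open ball, where an open set missing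
        \<open>closure T\<close> would lie in the interior of \<open>E k\<close>; taking closures
        then reaches \<open>?K\<close>.\<close>
      moreover have "ball p r \<subseteq> closure T"
      proof
        fix x assume x: "x \<in> ball p r"
        show "x \<in> closure T"
        proof (rule ccontr)
          assume "x \<notin> closure T"
          moreover have "ball p r \<inter> - closure T \<subseteq> E k"
            using closure_subset[of T] ball_subset_cball[of p r] unfolding T by blast
          then have "ball p r \<inter> - closure T \<subseteq> interior (E k)"
            by (intro interior_maximal open_Int open_ball open_Compl closed_closure)
          ultimately show False using x empty by blast
        qed
      qed
      then have "?K \<subseteq> closure T"
        using r by (metis closure_ball closure_closure closure_mono)
      ultimately show "openin (top_of_set ?K) T \<and> ?K \<subseteq> closure T" by blast
    qed auto
    moreover have "\<Inter>(range (\<lambda>k. ?K - E k)) = {}" using cover by blast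
    ultimately have "?K \<subseteq> {}" by (metis closure_empty)
    then show False using r by auto
  qed
  then obtain k q where "q \<in> interior (E k)" by blast
  then obtain \<delta> where "\<delta> > 0" "ball q \<delta> \<subseteq> E k"
    using mem_interior by blast
  then show ?thesis
    by (intro exI[of _ q] exI[of _ \<delta>] exI[of _ "real k"]) (auto simp: E_def)
qed

text \<open>Given \<open>x\<close> and \<open>y\<close>, the two points \<open>q + s *s u\<close> and \<open>q + cnj s *s u\<close> coincide for real \<open>s\<close>
  and equal \<open>x\<close> and \<open>y\<close> for \<open>s = \<i>\<close>.\<close>
lemma sesqui_holomorphic_polarization_ball:
  fixes N :: "'n::finite kern"
  assumes N: "sesqui_holomorphic (ball p r) N"
    and bd: "\<And>x y. x \<in> ball p r \<Longrightarrow> y \<in> ball p r \<Longrightarrow> cmod (N x y) \<le> B"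
    and diag: "\<And>x. x \<in> ball p r \<Longrightarrow> N x x = 0"
    and x: "x \<in> ball p (r/3)" and y: "y \<in> ball p (r/3)"
  shows "N x y = 0"
proof -
  define q where "q = (1/2) *s (x + y)"
  define u where "u = (1/(2*\<i>)) *s (x - y)"
  have xq: "q + \<i> *s u = x" "q + cnj \<i> *s u = y"
    by (simp_all add: q_def u_def vec_eq_iff field_simps)
  \<comment> \<open>Both \<open>q - p\<close> and \<open>u\<close> have norm below
    \<open>r/3\<close>, so parameters of modulus below 2 are admissible. This explains the radius
    \<open>r/3\<close> and leaves room for \<open>s = \<i>\<close>.\<close>
  have mem: "q + s *s u \<in> ball p r" if s: "s \<in> ball 0 2" for s
  proof -
    have "norm (q - p) = norm ((1/2) *s ((x - p) + (y - p)))"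
      by (rule arg_cong[of _ _ norm]) (simp add: q_def vec_eq_iff field_simps)
    also have "\<dots> = norm ((x - p) + (y - p)) / 2"
      by (subst norm_vector_smult) (simp add: norm_divide)
    also have "\<dots> \<le> (norm (x - p) + norm (y - p)) / 2"
      by (intro divide_right_mono norm_triangle_ineq) auto
    finally have 1: "norm (q - p) < r/3"
      using x y by (auto simp: dist_norm norm_minus_commute)
    have "norm u = norm ((x - p) - (y - p)) / 2"
      unfolding u_def by (subst norm_vector_smult) (simp add: norm_divide norm_mult)
    also have "\<dots> \<le> (norm (x - p) + norm (y - p)) / 2"
      by (intro divide_right_mono norm_triangle_ineq4) auto
    finally have 2: "norm u < r/3"
      using x y by (auto simp: dist_norm norm_minus_commute)
    have "norm (s *s u) \<le> 2 * norm u"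
      using s by (simp add: norm_vector_smult mult_right_mono)
    then have "norm ((q - p) + s *s u) < r"
      using 1 2 norm_triangle_ineq[of "q - p" "s *s u"] by linarith
    then show ?thesis by (simp add: dist_norm norm_minus_commute algebra_simps)
  qed
  \<comment> \<open>Conjugating \<open>t\<close> makes the antiholomorphic slot holomorphic, so the
    diagonal criterion applies to \<open>F\<close>.\<close>
  define F where "F = (\<lambda>s t. N (q + s *s u) (q + cnj t *s u))"
  have memc: "q + cnj t *s u \<in> ball p r" if "t \<in> ball 0 2" for t
    using that by (intro mem) auto
  have hol: "(\<lambda>s. F s s) holomorphic_on ball 0 2"
  proof (rule separately_holomorphic_diagonal[where F = F and B = B])
    fix t :: complex assume t: "t \<in> ball 0 2"
    show "(\<lambda>s. F s t) holomorphic_on ball 0 2"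
      unfolding F_def using N memc[OF t] mem
      by (intro holo_fun_on_complex_line[of "\<lambda>x. N x (q + cnj t *s u)"])
        (auto simp: sesqui_holomorphic_def)
  next
    fix s :: complex assume s: "s \<in> ball 0 2"
    have im: "cnj ` ball 0 2 = ball 0 2"
      by (auto simp: image_cnj_conv_vimage_cnj)
    have "(\<lambda>t. cnj (N (q + s *s u) (q + t *s u))) holomorphic_on ball 0 2"
      using N mem[OF s] mem
      by (intro holo_fun_on_complex_line[of "\<lambda>y. cnj (N (q + s *s u) y)"])
        (auto simp: sesqui_holomorphic_def antiholo_fun_on_def)
    then have "cnj \<circ> (\<lambda>t. cnj (N (q + s *s u) (q + t *s u))) \<circ> cnj holomorphic_on ball 0 2"
      by (intro holomorphic_on_compose_cnj_cnj) (auto simp: im)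
    then show "F s holomorphic_on ball 0 2" by (simp add: F_def o_def)
  next
    show "cmod (F s t) \<le> B" if "s \<in> ball 0 2" "t \<in> ball 0 2" for s t
      unfolding F_def using that by (intro bd mem memc)
  qed
  have "F \<i> \<i> = 0"
  \<comment> \<open>For real \<open>z\<close> both arguments in \<open>F z z\<close> are the same
    point of the ball, so \<open>F z z = 0\<close>; these zeros accumulate at 0.\<close>
  proof (rule analytic_continuation[OF hol, of "\<real> \<inter> ball 0 2" 0])
    have "0 islimpt (\<real> :: complex set)"
    proof (subst islimpt_approachable, intro allI impI)
      fix e :: real assume "e > 0"
      then show "\<exists>x'\<in>\<real>. x' \<noteq> 0 \<and> dist x' (0::complex) < e"
        by (intro bexI[of _ "of_real (e/2)"]) (auto simp: norm_divide)
    qed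
    then show "0 islimpt (\<real> \<inter> ball 0 2 :: complex set)"
      by (metis centre_in_ball islimpt_Int_eventually eventually_at_in_open' open_ball zero_less_numeral)
    show "F z z = 0" if "z \<in> \<real> \<inter> ball 0 2" for z
      using that mem[of z] diag by (auto simp: F_def elim!: Reals_cases simp del: mem_ball)
  qed auto
  then show ?thesis by (simp only: F_def xq)
qed

text \<open>Vanishing on a small \<open>V \<times> V\<close> spreads by the identity theorem, first
  in the first variable for fixed \<open>b\<close> in \<open>V\<close>, then in the conjugated
  second variable.\<close>

lemma sesqui_holomorphic_polarization:
  fixes N :: "'n::finite kern"
  assumes X: "open X" "connected X" and N: "sesqui_holomorphic X N"
    and diag: "\<And>x. x \<in> X \<Longrightarrow> N x x = 0" and x: "x \<in> X" and y: "y \<in> X"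
  shows "N x y = 0"
proof -
  obtain r where r: "r > 0" "cball x r \<subseteq> X"
    using X(1) x open_contains_cball by blast
  obtain q \<delta> B where \<delta>: "\<delta> > 0" "ball q \<delta> \<subseteq> cball x r"
    and B: "\<forall>a\<in>cball x r. \<forall>b\<in>ball q \<delta>. cmod (N a b) \<le> B"
    using sesqui_holomorphic_locally_bounded[OF N r(2,1)] by blast
  define V where "V = ball q (\<delta>/3)"
  have sub: "ball q \<delta> \<subseteq> X" using \<delta> r by blast
  have V: "open V" "V \<noteq> {}" "V \<subseteq> X" using \<delta>(1) sub by (auto simp: V_def)
  have "sesqui_holomorphic (ball q \<delta>) N"
    using N sub unfolding sesqui_holomorphic_def antiholo_fun_on_def holo_fun_on_def by blast
  then have VV: "N a b = 0" if "a \<in> V" "b \<in> V" for a b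
  proof (rule sesqui_holomorphic_polarization_ball)
    show "cmod (N a b) \<le> B" if "a \<in> ball q \<delta>" "b \<in> ball q \<delta>" for a b
      using that \<delta>(2) B by blast
    show "N a a = 0" if "a \<in> ball q \<delta>" for a
      using that sub by (intro diag) auto
  qed (use that in \<open>simp_all add: V_def\<close>)
  have XV: "N x b = 0" if b: "b \<in> V" for b
  proof (rule holo_fun_on_identity[OF _ X V _ x, of "\<lambda>a. N a b"])
    show "holo_fun_on (\<lambda>a. N a b) X"
      using N V b unfolding sesqui_holomorphic_def by blast
  qed (use VV b in auto)
  have "cnj (N x y) = 0"
  proof (rule holo_fun_on_identity[OF _ X V _ y, of "\<lambda>b. cnj (N x b)"])
    show "holo_fun_on (\<lambda>b. cnj (N x b)) X"
      using N x unfolding sesqui_holomorphic_def antiholo_fun_on_def by blast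
  qed (use XV in auto)
  then show ?thesis by simp
qed

section \<open>Invariance of the quotient on the diagonal\<close>

theorem proposition4p6:
  fixes X :: "(complex^'n) set"
    and L M :: "complex^'n \<Rightarrow> complex^'n \<Rightarrow> complex"
    and \<omega>L \<omega>M :: "(complex^'n \<Rightarrow> complex^'n) \<Rightarrow> complex^'n \<Rightarrow> complex"
  assumes "complex_domain X" and "homogeneous_set X"
    and "nondegenerate X L" and "sesqui_holomorphic X L" and "projectively_invariant X L"
    and "nondegenerate X M" and "sesqui_holomorphic X M" and "projectively_invariant X M"
    and "is_multiplier X L \<omega>L" and "is_multiplier X M \<omega>M"
    and "multiplier_equiv X \<omega>L \<omega>M"
  shows "\<exists>c::real. c > 0 \<and> (\<forall>x\<in>X. \<forall>y\<in>X. M x y = complex_of_real c * L x y)"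
proof (cases "X = {}")
  case True
  then show ?thesis by (intro exI[of _ 1]) auto
next
  case False
  then obtain p where p: "p \<in> X" by blast
  have pos: "\<exists>l. l > 0 \<and> K x x = complex_of_real l" if "nondegenerate X K" "x \<in> X" for K x
    using that unfolding nondegenerate_def by (metis of_real_Re)
  obtain l m where lm: "l > 0" "L p p = complex_of_real l" "m > 0" "M p p = complex_of_real m"
    using pos[OF assms(3) p] pos[OF assms(6) p] by blast
  \<comment> \<open>The value at the base point \<open>p\<close> forces this choice of
    \<open>c\<close>.\<close>
  define c where "c = m / l"
  have diag: "M x x = complex_of_real c * L x x" if x: "x \<in> X" for x
  proof -
    \<comment> \<open>Moving \<open>x\<close> to \<open>p\<close> lets the multiplier identities
      express \<open>L x x\<close> and \<open>M x x\<close> through the values at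
      \<open>p\<close>.\<close>
    obtain \<Phi> where \<Phi>: "\<Phi> \<in> Aut X" "\<Phi> x = p"
      using assms(2) p x unfolding homogeneous_set_def by blast
    obtain t where t: "cmod t = 1" "\<omega>L \<Phi> x = t * \<omega>M \<Phi> x"
      using assms(11) \<Phi>(1) x unfolding multiplier_equiv_def by fastforce
    have "L x x = \<omega>L \<Phi> x * cnj (\<omega>L \<Phi> x) * L p p"
      "M x x = \<omega>M \<Phi> x * cnj (\<omega>M \<Phi> x) * M p p"
      using assms(9,10) \<Phi> x unfolding is_multiplier_def rescales_def pull_def by metis+
    \<comment> \<open>Each side is a squared modulus, so the unimodular factor \<open>t\<close>
      drops out.\<close>
    moreover have "\<omega>L \<Phi> x * cnj (\<omega>L \<Phi> x) = \<omega>M \<Phi> x * cnj (\<omega>M \<Phi> x)"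
      by (simp only: t norm_mult mult_1 flip: complex_norm_square)
    ultimately show ?thesis using lm by (simp add: c_def)
  qed
  have "M x y - complex_of_real c * L x y = 0" if "x \<in> X" "y \<in> X" for x y
  proof (rule sesqui_holomorphic_polarization[where
        N = "\<lambda>x y. M x y - complex_of_real c * L x y" and X = X])
    show "sesqui_holomorphic X (\<lambda>x y. M x y - complex_of_real c * L x y)"
      using assms(4,7) by (intro sesqui_holomorphic_diff_cmult)
  qed (use that assms(1) diag in \<open>auto simp: complex_domain_def\<close>)
  then show ?thesis
    using lm by (intro exI[of _ c]) (simp add: c_def)
qed

end
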